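(* Let $D=(E,\mathcal{F})$ be a delta-matroid and let $<$ be any total order on $E$. For $F\in\mathcal{F}$, let $i(F)$ be the number of points of $E$ that are internal, active, and orientable with respect to $F$, and let $j(F)$ be the number of points of $E$ that are external, active, and orientable with respect to $F$. Then $$Q_{(w,x,0)}(D;y)=\sum_{F\in\mathcal{F}} w^{|E|-|F|}\,x^{|F|}\,\bigl(1+(w/x)y\bigr)^{i(F)}\bigl(1+(x/w)y\bigr)^{j(F)} .$$
   Context: A delta-matroid is a pair $D=(E,\mathcal{F})$ where $E$ is a finite set and $\mathcal{F}$ is a nonempty collection of subsets of $E$ (the feasible sets) such that for all $X,Y\in\mathcal{F}$ and $a\in X\Delta Y$ there exists $b\in X\Delta Y$, not necessarily distinct from $a$, with $X\Delta\{a,b\}\in\mathcal{F}$ ($\Delta$ is symmetric difference). For $X\subseteq E$ the twist is $D*X=(E,\{X\Delta F: F\in\mathcal{F}\})$, which is again a delta-matroid. Transition polynomial: let $r_{\min}(D)$ denote the minimum cardinality of a feasible set of $D$. Let $P_3$ be the set of ordered triples $(A,B,C)$ of pairwise disjoint (possibly empty) subsets of $E$ with union $E$. Define $Q_{(w,x,z)}(D;y)=\sum_{(A,B,C)\in P_3} w^{|A|}x^{|B|}z^{|C|}y^{r_{\min}(D*B)}$, with $w,x,y,z$ indeterminates. With $z=0$ (and $0^0=1$) this is $Q_{(w,x,0)}(D;y)=\sum_{B\subseteq E} w^{|E\setminus B|}x^{|B|}y^{r_{\min}(D*B)}$. Activities: fix $F\in\mathcal{F}$. A point $a\in E$ is $F$-nonorientable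 if $\{a\}$ is feasible in $D*F$, and $F$-orientable (orientable with respect to $F$) otherwise. A pair $\{a,b\}\subseteq E$, $a\neq b$, is $F$-paired if $\{a,b\}$ is feasible in $D*F$, and $F$-separated otherwise. Distinct points $a,b$ are $F$-interlaced if either (1) at most one of $a,b$ is $F$-nonorientable and $\{a,b\}$ is $F$-paired, or (2) both $a$ and $b$ are $F$-nonorientable and $\{a,b\}$ is $F$-separated. Given a total order $<$ on $E$, a point $a$ is active with respect to $F$ if $a$ is not $F$-interlaced with any lower-ordered point. A point $a$ is internal (with respect to $F$) if $a\in F$ and external otherwise. *)

theory Defs
  imports Main
begin

text \<open>
  A delta-matroid \<open>D = (E, \<F>)\<close> is given by its ground set \<open>E\<close> and its collection \<open>\<F>\<close> of
  feasible sets. Note that \<open>{a, b} = {a}\<close> when \<open>a = b\<close>.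
\<close>

locale delta_matroid =
  fixes E :: "'e set" and \<F> :: "'e set set"
  assumes finite_ground: "finite E"
    and feasible_subset: "F \<in> \<F> \<Longrightarrow> F \<subseteq> E"
    and feasible_nonempty: "\<F> \<noteq> {}"
    and symmetric_exchange:
      "\<lbrakk>X \<in> \<F>; Y \<in> \<F>; a \<in> sym_diff X Y\<rbrakk> \<Longrightarrow> \<exists>b \<in> sym_diff X Y. sym_diff X {a, b} \<in> \<F>"

text \<open>The twist does not change the ground set, so only the feasible sets are returned.\<close>

definition twist :: "'e set set \<Rightarrow> 'e set \<Rightarrow> 'e set set" where
  "twist \<F> X = {sym_diff X F | F. F \<in> \<F>}"

lemma delta_matroid_twist:
  assumes "delta_matroid E \<F>" and "X \<subseteq> E"
  shows "delta_matroid E (twist \<F> X)"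
proof -
  interpret delta_matroid E \<F> by fact
  show ?thesis
  proof
    show "finite E" by (rule finite_ground)
    show "G \<subseteq> E" if "G \<in> twist \<F> X" for G
      using that feasible_subset \<open>X \<subseteq> E\<close> by (auto simp: twist_def)
    show "twist \<F> X \<noteq> {}"
      using feasible_nonempty by (auto simp: twist_def)
  next
    fix G H a
    assume "G \<in> twist \<F> X" "H \<in> twist \<F> X" and a: "a \<in> sym_diff G H"
    then obtain F F' where F: "F \<in> \<F>" "G = sym_diff X F" and F': "F' \<in> \<F>" "H = sym_diff X F'"
      by (auto simp: twist_def)
    have eq: "sym_diff G H = sym_diff F F'"
      using F F' by blast
    obtain b where b: "b \<in> sym_diff F F'" "sym_diff F {a, b} \<in> \<F>"
      using symmetric_exchange F(1) F'(1) a eq by metis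
    have "sym_diff G {a, b} = sym_diff X (sym_diff F {a, b})"
      using F by blast
    then show "\<exists>b \<in> sym_diff G H. sym_diff G {a, b} \<in> twist \<F> X"
      using b eq unfolding twist_def by blast
  qed
qed

definition r_min :: "'e set set \<Rightarrow> nat" where
  "r_min \<F> = Min (card ` \<F>)"

definition P3 :: "'e set \<Rightarrow> ('e set \<times> 'e set \<times> 'e set) set" where
  "P3 E = {(A, B, C). A \<union> B \<union> C = E \<and> A \<inter> B = {} \<and> A \<inter> C = {} \<and> B \<inter> C = {}}"

text \<open>
  The transition polynomial is given by its values in an arbitrary commutative semiring. The
  polynomial itself is the value at the indeterminates of a polynomial ring (or of its field of
  fractions). Setting \<open>z = 0\<close> uses the convention \<open>0 ^ 0 = 1\<close>, which is that of \<open>power\<close>.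
\<close>

definition transition_poly ::
  "'e set \<Rightarrow> 'e set set \<Rightarrow> 'a \<Rightarrow> 'a \<Rightarrow> 'a \<Rightarrow> 'a \<Rightarrow> 'a::comm_semiring_1" where
  "transition_poly E \<F> w x z y =
     (\<Sum>(A, B, C) \<in> P3 E. w ^ card A * x ^ card B * z ^ card C * y ^ r_min (twist \<F> B))"

definition nonorientable :: "'e set set \<Rightarrow> 'e set \<Rightarrow> 'e \<Rightarrow> bool" where
  "nonorientable \<F> F a \<longleftrightarrow> {a} \<in> twist \<F> F"

abbreviation orientable :: "'e set set \<Rightarrow> 'e set \<Rightarrow> 'e \<Rightarrow> bool" where
  "orientable \<F> F a \<equiv> \<not> nonorientable \<F> F a"

text \<open>The notions \<open>paired\<close> and \<open>separated\<close> are only meaningful for distinct \<open>a\<close> and \<open>b\<close>.\<close>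

definition paired :: "'e set set \<Rightarrow> 'e set \<Rightarrow> 'e \<Rightarrow> 'e \<Rightarrow> bool" where
  "paired \<F> F a b \<longleftrightarrow> {a, b} \<in> twist \<F> F"

abbreviation separated :: "'e set set \<Rightarrow> 'e set \<Rightarrow> 'e \<Rightarrow> 'e \<Rightarrow> bool" where
  "separated \<F> F a b \<equiv> \<not> paired \<F> F a b"

definition interlaced :: "'e set set \<Rightarrow> 'e set \<Rightarrow> 'e \<Rightarrow> 'e \<Rightarrow> bool" where
  "interlaced \<F> F a b \<longleftrightarrow> a \<noteq> b \<and>
     ((\<not> (nonorientable \<F> F a \<and> nonorientable \<F> F b) \<and> paired \<F> F a b) \<or>
      (nonorientable \<F> F a \<and> nonorientable \<F> F b \<and> separated \<F> F a b))"

text \<open>The relation \<open>r\<close> is a strict order: \<open>(b, a) \<in> r\<close> means that \<open>b\<close> is lower than \<open>a\<close>.\<close>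

definition active :: "'e set \<Rightarrow> 'e set set \<Rightarrow> 'e rel \<Rightarrow> 'e set \<Rightarrow> 'e \<Rightarrow> bool" where
  "active E \<F> r F a \<longleftrightarrow> (\<forall>b\<in>E. (b, a) \<in> r \<longrightarrow> \<not> interlaced \<F> F a b)"

definition internal :: "'e set \<Rightarrow> 'e \<Rightarrow> bool" where
  "internal F a \<longleftrightarrow> a \<in> F"

abbreviation external :: "'e set \<Rightarrow> 'e \<Rightarrow> bool" where
  "external F a \<equiv> \<not> internal F a"

definition int_act :: "'e set \<Rightarrow> 'e set set \<Rightarrow> 'e rel \<Rightarrow> 'e set \<Rightarrow> nat" where
  "int_act E \<F> r F = card {a \<in> E. internal F a \<and> active E \<F> r F a \<and> orientable \<F> F a}"

definition ext_act :: "'e set \<Rightarrow> 'e set set \<Rightarrow> 'e rel \<Rightarrow> 'e set \<Rightarrow> nat" where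
  "ext_act E \<F> r F = card {a \<in> E. external F a \<and> active E \<F> r F a \<and> orientable \<F> F a}"

end

theory Submission
  imports Defs
begin

text \<open>
  Expanding the two powers of binomials turns the right-hand side into a sum over pairs \<open>(F, S)\<close>,
  where \<open>F\<close> is feasible and \<open>S\<close> is a set of active orientable points of \<open>F\<close>; the pair contributes
  the weight of \<open>B = F \<Delta> S\<close> times \<open>y ^ card S\<close>. It remains to see that each \<open>B\<close> arises from
  exactly one pair, and that \<open>card S = r_min (D * B)\<close>. As activities are invariant under twisting,
  this is a statement about \<open>D * B\<close>: exactly one feasible set consists of active orientable points
  only, and it has minimum cardinality. It is found by going through the points from the highest
  to the lowest, avoiding each point if possible.
\<close>

section \<open>Invariance of activities under twisting\<close>

lemma mem_twist_iff: "G \<in> twist \<F> X \<longleftrightarrow> sym_diff X G \<in> \<F>"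
proof
  assume "G \<in> twist \<F> X"
  then obtain F where "F \<in> \<F>" "G = sym_diff X F"
    by (auto simp: twist_def)
  moreover from this have "sym_diff X G = F" by blast
  ultimately show "sym_diff X G \<in> \<F>" by simp
next
  assume "sym_diff X G \<in> \<F>"
  moreover have "G = sym_diff X (sym_diff X G)" by blast
  ultimately show "G \<in> twist \<F> X"
    unfolding twist_def by blast
qed

text \<open>Twists compose by symmetric difference, and \<open>B\<close> cancels. Orientability and
  interlacement with respect to \<open>F\<close> are read off \<open>twist \<F> F\<close>, so they
  survive a twist by \<open>B\<close>, which carries \<open>F\<close> to
  \<open>sym_diff B F\<close>.\<close>

lemma twist_twist_sym_diff: "twist (twist \<F> B) (sym_diff B F) = twist \<F> F"
proof -
  have "sym_diff B (sym_diff (sym_diff B F) G) = sym_diff F G" for G by blast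
  then show ?thesis
    by (intro set_eqI) (simp only: mem_twist_iff)
qed

lemma active_twist: "active E (twist \<F> B) r (sym_diff B F) = active E \<F> r F"
  by (simp add: fun_eq_iff active_def interlaced_def nonorientable_def paired_def
      twist_twist_sym_diff)

lemma nonorientable_twist: "nonorientable (twist \<F> B) (sym_diff B F) = nonorientable \<F> F"
  by (simp add: fun_eq_iff nonorientable_def twist_twist_sym_diff)

text \<open>One set serves both activities: \<open>int_act\<close> counts its points in
  \<open>F\<close>, \<open>ext_act\<close> those outside \<open>F\<close>.\<close>

definition active_orientable :: "'e set \<Rightarrow> 'e set set \<Rightarrow> 'e rel \<Rightarrow> 'e set \<Rightarrow> 'e set" where
  "active_orientable E \<F> r F = {a \<in> E. active E \<F> r F a \<and> orientable \<F> F a}"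

lemma active_orientable_twist:
  "active_orientable E (twist \<F> B) r (sym_diff B F) = active_orientable E \<F> r F"
  by (simp add: active_orientable_def active_twist nonorientable_twist)

text \<open>For orientable \<open>a\<close> only the first kind of interlacement can occur, and it
  amounts to feasibility of \<open>sym_diff F {a, b}\<close>. Irreflexivity makes a lower
  \<open>b\<close> distinct from \<open>a\<close>.\<close>

lemma mem_active_orientable_iff:
  assumes "irrefl r"
  shows "a \<in> active_orientable E \<F> r F \<longleftrightarrow>
    a \<in> E \<and> sym_diff F {a} \<notin> \<F> \<and> (\<forall>b\<in>E. (b, a) \<in> r \<longrightarrow> sym_diff F {a, b} \<notin> \<F>)"
  using assms
  by (auto simp: active_orientable_def active_def interlaced_def nonorientable_def paired_def
      mem_twist_iff irrefl_def)

section \<open>The unique feasible set of active orientable points\<close>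

text \<open>An exchange toggles only points of \<open>sym_diff X Y\<close>, so \<open>e\<close>
  stays out if both sets avoid it. The set \<open>G\<close> ensures nonemptiness.\<close>

lemma (in delta_matroid) delta_matroid_avoiding:
  assumes "G \<in> \<F>" "e \<notin> G"
  shows "delta_matroid E {F \<in> \<F>. e \<notin> F}"
proof
  fix X Y a
  assume "X \<in> {F \<in> \<F>. e \<notin> F}" "Y \<in> {F \<in> \<F>. e \<notin> F}" and a: "a \<in> sym_diff X Y"
  then have X: "X \<in> \<F>" "e \<notin> X" and Y: "Y \<in> \<F>" "e \<notin> Y" by auto
  obtain b where b: "b \<in> sym_diff X Y" "sym_diff X {a, b} \<in> \<F>"
    using symmetric_exchange[OF X(1) Y(1) a] by blast
  moreover have "e \<notin> sym_diff X {a, b}" using a b(1) X Y by blast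
  ultimately show "\<exists>b\<in>sym_diff X Y. sym_diff X {a, b} \<in> {F \<in> \<F>. e \<notin> F}" by blast
qed (use finite_ground feasible_subset assms in auto)

text \<open>
  The set \<open>U\<close> contains the points that have not been decided yet. Keeping the ground set and
  shrinking \<open>U\<close> replaces deletion and contraction of points.
\<close>

lemma unique_active_feasible_aux:
  assumes "finite U" "delta_matroid E \<F>" "strict_linear_order_on U r"
    and "\<And>F G. F \<in> \<F> \<Longrightarrow> G \<in> \<F> \<Longrightarrow> sym_diff F G \<subseteq> U"
  shows "\<exists>F\<in>\<F>. \<forall>G\<in>\<F>. card F \<le> card G \<and>
    ((\<forall>a\<in>G \<inter> U. sym_diff G {a} \<notin> \<F> \<and> (\<forall>b\<in>U. (b, a) \<in> r \<longrightarrow> sym_diff G {a, b} \<notin> \<F>))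
      \<longleftrightarrow> G = F)"
  using assms
proof (induction U arbitrary: \<F> rule: finite_psubset_induct)
  case (psubset U)
  interpret D: delta_matroid E \<F> by fact
  \<comment> \<open>The undecided points of \<open>G\<close> are active and orientable, with only
    undecided points tested as lower ones. As a predicate in \<open>\<F>\<close> and
    \<open>U\<close> it can be compared before and after a point is decided.\<close>
  define good where "good \<F> U G \<longleftrightarrow>
      (\<forall>a\<in>G \<inter> U. sym_diff G {a} \<notin> \<F> \<and> (\<forall>b\<in>U. (b, a) \<in> r \<longrightarrow> sym_diff G {a, b} \<notin> \<F>))"
    for \<F> U G
  have "\<exists>F\<in>\<F>. \<forall>G\<in>\<F>. card F \<le> card G \<and> (good \<F> U G \<longleftrightarrow> G = F)"
  proof (cases "U = {}")
    case True
    obtain F where F: "F \<in> \<F>" using D.feasible_nonempty by blast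
    then have "G = F" if "G \<in> \<F>" for G
      using psubset.prems(3)[OF that F] True by blast
    then show ?thesis using F True by (auto simp: good_def)
  next
    case False
    have "transp_on U (\<lambda>b a. (b, a) \<in> r)" "totalp_on U (\<lambda>b a. (b, a) \<in> r)"
      using psubset.prems(2)
      by (auto simp: strict_linear_order_on_def totalp_on_def total_on_def
          intro!: transp_onI dest: transD)
    then obtain e where e: "e \<in> U" and e_max: "\<And>b. b \<in> U \<Longrightarrow> b \<noteq> e \<Longrightarrow> (b, e) \<in> r"
      using Finite_Set.bex_greatest_element[OF psubset.hyps False] by blast
    \<comment> \<open>The highest undecided point \<open>e\<close> is decided: it is avoided if some
      feasible set avoids it; otherwise every feasible set contains it. Either way the members of
      \<open>\<F>'\<close> agree on \<open>e\<close>, so \<open>e\<close> can leave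
      \<open>U\<close>.\<close>
    define \<F>' where "\<F>' = (if \<exists>G\<in>\<F>. e \<notin> G then {F \<in> \<F>. e \<notin> F} else \<F>)"
    have sub: "\<F>' \<subseteq> \<F>" by (auto simp: \<F>'_def)
    have agree: "e \<in> F \<longleftrightarrow> e \<in> G" if "F \<in> \<F>'" "G \<in> \<F>'" for F G
      using that by (auto simp: \<F>'_def split: if_splits)
    have mem: "G \<in> \<F>' \<longleftrightarrow> G \<in> \<F>" if "F \<in> \<F>'" "e \<in> F \<longleftrightarrow> e \<in> G" for F G
      using that by (auto simp: \<F>'_def split: if_splits)
    have dm: "delta_matroid E \<F>'"
      using D.delta_matroid_avoiding psubset.prems(1) by (auto simp: \<F>'_def)
    have lin: "strict_linear_order_on (U - {e}) r"
      using psubset.prems(2) by (auto simp: strict_linear_order_on_def intro: total_on_subset)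
    have diff: "sym_diff F G \<subseteq> U - {e}" if "F \<in> \<F>'" "G \<in> \<F>'" for F G
      using psubset.prems(3)[of F G] agree[OF that] that sub by blast
    have "U - {e} \<subset> U" using e by blast
    from psubset.IH[OF this dm lin diff]
    have "\<exists>F\<in>\<F>'. \<forall>G\<in>\<F>'. card F \<le> card G \<and> (good \<F>' (U - {e}) G \<longleftrightarrow> G = F)"
      by (simp only: good_def)
    then obtain F where F: "F \<in> \<F>'"
      and F_unique: "\<And>G. G \<in> \<F>' \<Longrightarrow> card F \<le> card G \<and> (good \<F>' (U - {e}) G \<longleftrightarrow> G = F)"
      by blast
    \<comment> \<open>Being highest, \<open>e\<close> is never among the lower points tested for
      another \<open>a\<close>.\<close>
    have lower: "b \<in> U - {e}" if "b \<in> U" "(b, a) \<in> r" "a \<in> U - {e}" for a b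
      using that e_max[of a] psubset.prems(2)
      unfolding strict_linear_order_on_def irrefl_def
      by (metis DiffD1 DiffD2 DiffI singletonD singletonI transD)
    \<comment> \<open>Toggling points other than \<open>e\<close> cannot lead from
      \<open>\<F>'\<close> to a feasible set outside it, so the tests at \<open>a \<noteq> e\<close>
      have the same outcome in both systems.\<close>
    have good_iff: "good \<F> U G \<longleftrightarrow> good \<F>' (U - {e}) G" if G: "G \<in> \<F>'" for G
    proof -
      have one: "sym_diff G {a} \<in> \<F>' \<longleftrightarrow> sym_diff G {a} \<in> \<F>" if "a \<noteq> e" for a
        using that by (intro mem[OF G]) auto
      have two: "sym_diff G {a, b} \<in> \<F>' \<longleftrightarrow> sym_diff G {a, b} \<in> \<F>" if "a \<noteq> e" "b \<noteq> e" for a b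
        using that by (intro mem[OF G]) auto
      have below: "(\<forall>b\<in>U. (b, a) \<in> r \<longrightarrow> P b) \<longleftrightarrow> (\<forall>b\<in>U - {e}. (b, a) \<in> r \<longrightarrow> P b)"
        if "a \<in> U - {e}" for a P
        using that lower by blast
      have away: "(sym_diff G {a} \<notin> \<F> \<and> (\<forall>b\<in>U. (b, a) \<in> r \<longrightarrow> sym_diff G {a, b} \<notin> \<F>)) \<longleftrightarrow>
          (sym_diff G {a} \<notin> \<F>' \<and> (\<forall>b\<in>U - {e}. (b, a) \<in> r \<longrightarrow> sym_diff G {a, b} \<notin> \<F>'))"
        if "a \<in> U - {e}" for a
        unfolding below[OF that] using one two that by (metis Diff_iff singletonI)
      \<comment> \<open>A member of \<open>\<F>'\<close> contains \<open>e\<close> only if every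
        feasible set does, whereas the toggled sets lack \<open>e\<close>.\<close>
      have at_e: "sym_diff G {e} \<notin> \<F> \<and> (\<forall>b\<in>U. (b, e) \<in> r \<longrightarrow> sym_diff G {e, b} \<notin> \<F>)" if "e \<in> G"
      proof -
        have "e \<in> H" if "H \<in> \<F>" for H
          using that G \<open>e \<in> G\<close> by (auto simp: \<F>'_def split: if_splits)
        then show ?thesis using that by blast
      qed
      have "good \<F> U G \<longleftrightarrow> (\<forall>a\<in>G \<inter> (U - {e}).
          sym_diff G {a} \<notin> \<F> \<and> (\<forall>b\<in>U. (b, a) \<in> r \<longrightarrow> sym_diff G {a, b} \<notin> \<F>))"
        unfolding good_def using at_e by (metis (no_types, lifting) Diff_iff Int_iff singletonD)
      also have "\<dots> \<longleftrightarrow> good \<F>' (U - {e}) G"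
        unfolding good_def using away by (intro ball_cong refl) blast
      finally show ?thesis .
    qed
    \<comment> \<open>Here \<open>e\<close> lies in \<open>G\<close> but not in \<open>F\<close>.
      Exchanging \<open>e\<close> in \<open>G\<close> towards \<open>F\<close> yields a feasible
      \<open>sym_diff G {e, b}\<close>. If \<open>b = e\<close>, then \<open>e\<close> is
      nonorientable; otherwise \<open>b\<close> is lower than \<open>e\<close>, and the test at
      \<open>e\<close> fails again. The new set lies in \<open>\<F>'\<close> and is no larger than
      \<open>G\<close>, since \<open>e\<close> leaves and at most \<open>b\<close> enters.\<close>
    have not_good: "\<not> good \<F> U G \<and> (\<exists>H\<in>\<F>'. card H \<le> card G)" if G: "G \<in> \<F>" "G \<notin> \<F>'" for G
    proof -
      from G have eG: "e \<in> G" by (auto simp: \<F>'_def split: if_splits)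
      have "e \<in> sym_diff G F"
        using mem[OF F, of G] G eG by blast
      then obtain b where b: "b \<in> sym_diff G F" "sym_diff G {e, b} \<in> \<F>"
        using D.symmetric_exchange[of G F e] G F sub by blast
      have bU: "b \<in> U" using b(1) psubset.prems(3)[of G F] G F sub by blast
      have "\<not> good \<F> U G"
      proof (cases "b = e")
        case True
        then show ?thesis using b e eG by (auto simp: good_def)
      next
        case False
        then show ?thesis using b e eG bU e_max[OF bU] unfolding good_def by blast
      qed
      moreover have "sym_diff G {e, b} \<in> \<F>'"
        using mem[OF F, of "sym_diff G {e, b}"] b \<open>e \<in> sym_diff G F\<close> eG by blast
      moreover have "card (sym_diff G {e, b}) \<le> card G"
      proof -
        have "finite G" using G D.feasible_subset D.finite_ground finite_subset by blast
        moreover have "sym_diff G {e, b} \<subseteq> insert b (G - {e})" using eG by blast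
        ultimately have "card (sym_diff G {e, b}) \<le> card (insert b (G - {e}))"
          by (intro card_mono) auto
        also have "\<dots> \<le> Suc (card (G - {e}))" by (rule card_insert_le_m1) auto
        also have "\<dots> = card G" using \<open>finite G\<close> eG by (rule card_Suc_Diff1)
        finally show ?thesis .
      qed
      ultimately show ?thesis by blast
    qed
    have "card F \<le> card G \<and> (good \<F> U G \<longleftrightarrow> G = F)" if "G \<in> \<F>" for G
    proof (cases "G \<in> \<F>'")
      case True
      then show ?thesis using F_unique good_iff by blast
    next
      case False
      then show ?thesis using not_good[OF that False] F_unique F le_trans by blast
    qed
    then show ?thesis using F sub by blast
  qed
  then show ?case by (simp only: good_def)
qed

text \<open>This is the induction at \<open>U = E\<close>, where every point is still
  undecided.\<close>

lemma unique_active_feasible: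
  assumes "delta_matroid E \<F>" "strict_linear_order_on E r"
  shows "\<exists>F\<in>\<F>. card F = r_min \<F> \<and> (\<forall>G\<in>\<F>. G \<subseteq> active_orientable E \<F> r G \<longleftrightarrow> G = F)"
proof -
  interpret delta_matroid E \<F> by fact
  have irr: "irrefl r" using assms(2) by (simp add: strict_linear_order_on_def)
  have "finite \<F>"
    using finite_ground feasible_subset by (meson Pow_iff finite_Pow_iff finite_subset subsetI)
  have "G \<subseteq> active_orientable E \<F> r G \<longleftrightarrow> (\<forall>a\<in>G \<inter> E. sym_diff G {a} \<notin> \<F> \<and>
      (\<forall>b\<in>E. (b, a) \<in> r \<longrightarrow> sym_diff G {a, b} \<notin> \<F>))" if "G \<in> \<F>" for G
    using feasible_subset[OF that] by (auto simp: mem_active_orientable_iff[OF irr])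
  moreover have "sym_diff F G \<subseteq> E" if "F \<in> \<F>" "G \<in> \<F>" for F G
    using that feasible_subset by blast
  ultimately obtain F where F: "F \<in> \<F>" "\<forall>G\<in>\<F>. card F \<le> card G \<and>
      (G \<subseteq> active_orientable E \<F> r G \<longleftrightarrow> G = F)"
    using unique_active_feasible_aux[OF finite_ground assms] by (smt (verit))
  then have "r_min \<F> = card F"
    unfolding r_min_def using \<open>finite \<F>\<close> by (intro Min_eqI) auto
  then show ?thesis using F by auto
qed

text \<open>The feasible sets of the twist by \<open>B\<close> are the sets
  \<open>sym_diff B G\<close>, each with the active orientable points of \<open>G\<close>, so the
  unique one found there translates back.\<close>

lemma unique_active_decomposition:
  assumes "delta_matroid E \<F>" "strict_linear_order_on E r" "B \<subseteq> E"
  shows "\<exists>F\<in>\<F>. card (sym_diff B F) = r_min (twist \<F> B) \<and>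
    (\<forall>G\<in>\<F>. sym_diff B G \<subseteq> active_orientable E \<F> r G \<longleftrightarrow> G = F)"
proof -
  obtain K where K: "K \<in> twist \<F> B" "card K = r_min (twist \<F> B)"
    "\<forall>G\<in>twist \<F> B. G \<subseteq> active_orientable E (twist \<F> B) r G \<longleftrightarrow> G = K"
    using unique_active_feasible[OF delta_matroid_twist[OF assms(1,3)] assms(2)] by blast
  obtain F where F: "F \<in> \<F>" "K = sym_diff B F"
    using K(1) by (auto simp: twist_def)
  have "sym_diff B G \<subseteq> active_orientable E \<F> r G \<longleftrightarrow> G = F" if "G \<in> \<F>" for G
  proof -
    have "sym_diff B G \<in> twist \<F> B" using that by (auto simp: twist_def)
    then have "sym_diff B G \<subseteq> active_orientable E \<F> r G \<longleftrightarrow> sym_diff B G = sym_diff B F"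
      using K(3) unfolding F(2) by (metis active_orientable_twist)
    also have "\<dots> \<longleftrightarrow> G = F" by blast
    finally show ?thesis .
  qed
  then show ?thesis using F K(2) by blast
qed

section \<open>Expansion of the two sides\<close>

text \<open>A nonempty \<open>C\<close> contributes a factor \<open>0\<close>, and a triple with
  \<open>C = {}\<close> is determined by \<open>B\<close>.\<close>

lemma transition_poly_0:
  fixes E :: "'e set"
  assumes "finite E"
  shows "transition_poly E \<F> w x 0 y =
    (\<Sum>B\<in>Pow E. w ^ card (E - B) * x ^ card B * y ^ r_min (twist \<F> B))"
proof -
  let ?f = "\<lambda>(A, B, C). w ^ card A * x ^ card B * 0 ^ card C * y ^ r_min (twist \<F> B)"
  let ?h = "\<lambda>B. (E - B, B, {} :: 'e set)"
  have fin: "finite (P3 E)"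
    by (rule finite_subset[of _ "Pow E \<times> Pow E \<times> Pow E"]) (use assms in \<open>auto simp: P3_def\<close>)
  have zero: "?f p = 0" if "p \<in> P3 E - ?h ` Pow E" for p
  proof -
    obtain A B C where p: "p = (A, B, C)" by (cases p)
    have "C \<noteq> {}" using that p by (auto simp: P3_def image_iff)
    moreover have "finite C" using that p assms by (auto simp: P3_def)
    ultimately show ?thesis using p by (simp add: power_0_left)
  qed
  have "transition_poly E \<F> w x 0 y = sum ?f (P3 E)"
    by (simp add: transition_poly_def)
  also have "\<dots> = sum ?f (?h ` Pow E)"
  proof (rule sum.mono_neutral_right[OF fin])
    show "?h ` Pow E \<subseteq> P3 E" by (auto simp: P3_def)
  qed (use zero in blast)
  also have "\<dots> = (\<Sum>B\<in>Pow E. ?f (?h B))"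
    by (subst sum.reindex) (auto simp: inj_on_def)
  finally show ?thesis by simp
qed

lemma prod_if_mem:
  fixes x w :: "'a::comm_monoid_mult"
  assumes "finite A"
  shows "(\<Prod>a\<in>A. if a \<in> B then x else w) = w ^ card (A - B) * x ^ card (A \<inter> B)"
  using prod.If_cases[OF assms, of "\<lambda>a. a \<in> B" "\<lambda>_. x" "\<lambda>_. w"]
  by (simp add: Diff_eq mult.commute)

text \<open>Toggling a point multiplies the weight of \<open>F\<close> by \<open>w / x\<close> if
  the point is internal and by \<open>x / w\<close> if it is external. These are the coefficients of
  \<open>y\<close> in the two binomials, so choosing the term with \<open>y\<close> means
  toggling.\<close>

lemma expand_activities:
  fixes w x y :: "'a::field"
  assumes "delta_matroid E \<F>" "F \<in> \<F>" "w \<noteq> 0" "x \<noteq> 0"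
  shows "w ^ (card E - card F) * x ^ card F *
      (1 + (w / x) * y) ^ int_act E \<F> r F * (1 + (x / w) * y) ^ ext_act E \<F> r F =
    (\<Sum>S\<in>Pow (active_orientable E \<F> r F).
      w ^ card (E - sym_diff F S) * x ^ card (sym_diff F S) * y ^ card S)"
proof -
  interpret delta_matroid E \<F> by fact
  let ?A = "active_orientable E \<F> r F"
  \<comment> \<open>Written as a product over \<open>E\<close>, the weight can be compared point by
    point.\<close>
  let ?wt = "\<lambda>B. \<Prod>a\<in>E. if a \<in> B then x else w"
  let ?c = "\<lambda>a. if a \<in> F then w / x else x / w"
  have FE: "F \<subseteq> E" using assms(2) by (rule feasible_subset)
  have AE: "?A \<subseteq> E" by (auto simp: active_orientable_def)
  then have finA: "finite ?A" using finite_ground finite_subset by blast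
  have wt: "?wt B = w ^ card (E - B) * x ^ card B" if "B \<subseteq> E" for B
    using that by (simp add: prod_if_mem[OF finite_ground] Int_absorb1)
  have int: "?A \<inter> F = {a \<in> E. internal F a \<and> active E \<F> r F a \<and> orientable \<F> F a}"
    and ext: "?A - F = {a \<in> E. external F a \<and> active E \<F> r F a \<and> orientable \<F> F a}"
    by (auto simp: active_orientable_def internal_def)
  have "(1 + (w / x) * y) ^ int_act E \<F> r F * (1 + (x / w) * y) ^ ext_act E \<F> r F =
      (\<Prod>a\<in>?A. if a \<in> F then 1 + (w / x) * y else 1 + (x / w) * y)"
    unfolding int_act_def ext_act_def int[symmetric] ext[symmetric]
    by (simp add: prod_if_mem[OF finA] mult.commute)
  also have "\<dots> = (\<Prod>a\<in>?A. ?c a * y + 1)"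
    by (intro prod.cong) auto
  also have "\<dots> = (\<Sum>S\<in>Pow ?A. (\<Prod>a\<in>S. ?c a * y) * (\<Prod>a\<in>?A - S. 1))"
    by (rule prod_add[OF finA])
  also have "\<dots> = (\<Sum>S\<in>Pow ?A. (\<Prod>a\<in>S. ?c a) * y ^ card S)"
    by (simp add: prod.distrib)
  finally have expand: "(1 + (w / x) * y) ^ int_act E \<F> r F * (1 + (x / w) * y) ^ ext_act E \<F> r F =
      (\<Sum>S\<in>Pow ?A. (\<Prod>a\<in>S. ?c a) * y ^ card S)" .
  have shift: "?wt F * (\<Prod>a\<in>S. ?c a) = ?wt (sym_diff F S)" if "S \<subseteq> E" for S
  proof -
    have "(\<Prod>a\<in>S. ?c a) = (\<Prod>a\<in>E. if a \<in> S then ?c a else 1)"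
      using that finite_ground by (simp add: prod.If_cases Int_absorb1 Int_commute)
    then have "?wt F * (\<Prod>a\<in>S. ?c a) =
        (\<Prod>a\<in>E. (if a \<in> F then x else w) * (if a \<in> S then ?c a else 1))"
      by (simp add: prod.distrib)
    also have "\<dots> = ?wt (sym_diff F S)"
      using assms(3,4) by (intro prod.cong) auto
    finally show ?thesis .
  qed
  have "w ^ (card E - card F) * x ^ card F = ?wt F"
    using wt[OF FE] FE finite_ground by (simp add: card_Diff_subset finite_subset)
  then have "w ^ (card E - card F) * x ^ card F *
      (1 + (w / x) * y) ^ int_act E \<F> r F * (1 + (x / w) * y) ^ ext_act E \<F> r F =
      ?wt F * (\<Sum>S\<in>Pow ?A. (\<Prod>a\<in>S. ?c a) * y ^ card S)"
    by (simp only: expand mult.assoc)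
  also have "\<dots> = (\<Sum>S\<in>Pow ?A. ?wt (sym_diff F S) * y ^ card S)"
    unfolding sum_distrib_left
  proof (intro sum.cong refl)
    fix S assume "S \<in> Pow ?A"
    then have "S \<subseteq> E" using AE by blast
    then show "?wt F * ((\<Prod>a\<in>S. ?c a) * y ^ card S) = ?wt (sym_diff F S) * y ^ card S"
      by (simp only: shift[symmetric] mult.assoc)
  qed
  also have "\<dots> = (\<Sum>S\<in>Pow ?A. w ^ card (E - sym_diff F S) * x ^ card (sym_diff F S) * y ^ card S)"
  proof (intro sum.cong refl)
    fix S assume "S \<in> Pow ?A"
    then have "sym_diff F S \<subseteq> E" using AE FE by blast
    then show "?wt (sym_diff F S) * y ^ card S =
        w ^ card (E - sym_diff F S) * x ^ card (sym_diff F S) * y ^ card S"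
      by (simp only: wt)
  qed
  finally show ?thesis .
qed

section \<open>The bijection between pairs \<open>(F, S)\<close> and subsets
  \<open>B\<close>\<close>

theorem theorem4p15:
  fixes E :: "'e set" and \<F> :: "'e set set" and r :: "'e rel"
    and w x y :: "'a::field"
  assumes "delta_matroid E \<F>"
    and "strict_linear_order_on E r"
    and "w \<noteq> 0" and "x \<noteq> 0"
  shows "transition_poly E \<F> w x 0 y =
    (\<Sum>F\<in>\<F>. w ^ (card E - card F) * x ^ card F *
       (1 + (w / x) * y) ^ int_act E \<F> r F * (1 + (x / w) * y) ^ ext_act E \<F> r F)"
proof -
  interpret delta_matroid E \<F> by fact
  let ?A = "active_orientable E \<F> r"
  let ?t = "\<lambda>B. w ^ card (E - B) * x ^ card B"
  have AE: "?A F \<subseteq> E" for F by (auto simp: active_orientable_def)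
  have finA: "finite (?A F)" for F using AE finite_ground finite_subset by blast
  have finF: "finite \<F>"
    using finite_ground feasible_subset by (meson Pow_iff finite_Pow_iff finite_subset subsetI)
  \<comment> \<open>\<open>\<phi> B\<close> is the only feasible set that differs from
    \<open>B\<close> in active orientable points of its own alone.\<close>
  obtain \<phi> where \<phi>: "\<And>B. B \<subseteq> E \<Longrightarrow> \<phi> B \<in> \<F>"
    and card_\<phi>: "\<And>B. B \<subseteq> E \<Longrightarrow> card (sym_diff B (\<phi> B)) = r_min (twist \<F> B)"
    and \<phi>_unique: "\<And>B G. B \<subseteq> E \<Longrightarrow> G \<in> \<F> \<Longrightarrow> sym_diff B G \<subseteq> ?A G \<longleftrightarrow> G = \<phi> B"
    using unique_active_decomposition[OF assms(1,2)] by metis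
  have sd: "sym_diff F (sym_diff B F) = B" "sym_diff (sym_diff F S) F = S" for B F S :: "'e set"
    by blast+
  have "(\<Sum>F\<in>\<F>. w ^ (card E - card F) * x ^ card F *
       (1 + (w / x) * y) ^ int_act E \<F> r F * (1 + (x / w) * y) ^ ext_act E \<F> r F) =
      (\<Sum>F\<in>\<F>. \<Sum>S\<in>Pow (?A F). ?t (sym_diff F S) * y ^ card S)"
    using assms by (intro sum.cong refl expand_activities)
  also have "\<dots> = (\<Sum>(F, S)\<in>Sigma \<F> (\<lambda>F. Pow (?A F)). ?t (sym_diff F S) * y ^ card S)"
    using finF finA by (intro sum.Sigma) auto
  also have "\<dots> = (\<Sum>B\<in>Pow E. ?t B * y ^ r_min (twist \<F> B))"
  proof (rule sum.reindex_bij_witness[where i = "\<lambda>B. (\<phi> B, sym_diff B (\<phi> B))"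
        and j = "\<lambda>(F, S). sym_diff F S"])
    fix p assume "p \<in> Sigma \<F> (\<lambda>F. Pow (?A F))"
    then obtain F S where p: "p = (F, S)" and F: "F \<in> \<F>" and S: "S \<subseteq> ?A F" by auto
    have B: "sym_diff F S \<subseteq> E" using feasible_subset[OF F] S AE[of F] by blast
    \<comment> \<open>With \<open>B = sym_diff F S\<close>, the difference of \<open>B\<close> and
      \<open>F\<close> is \<open>S\<close>, which lies in \<open>?A F\<close>; uniqueness then
      recovers \<open>F\<close>.\<close>
    have \<phi>F: "\<phi> (sym_diff F S) = F"
      using \<phi>_unique[OF B F] S unfolding sd by simp
    show "(\<phi> (case p of (F, S) \<Rightarrow> sym_diff F S),
        sym_diff (case p of (F, S) \<Rightarrow> sym_diff F S) (\<phi> (case p of (F, S) \<Rightarrow> sym_diff F S))) = p"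
      unfolding p prod.case \<phi>F sd ..
    show "(case p of (F, S) \<Rightarrow> sym_diff F S) \<in> Pow E"
      unfolding p prod.case using B by (rule PowI)
    show "?t (case p of (F, S) \<Rightarrow> sym_diff F S) *
        y ^ r_min (twist \<F> (case p of (F, S) \<Rightarrow> sym_diff F S)) =
      (case p of (F, S) \<Rightarrow> ?t (sym_diff F S) * y ^ card S)"
      using card_\<phi>[OF B] unfolding p prod.case \<phi>F sd by (simp only:)
  next
    fix B assume "B \<in> Pow E"
    then have B: "B \<subseteq> E" by blast
    show "(case (\<phi> B, sym_diff B (\<phi> B)) of (F, S) \<Rightarrow> sym_diff F S) = B"
      unfolding prod.case sd ..
    show "(\<phi> B, sym_diff B (\<phi> B)) \<in> Sigma \<F> (\<lambda>F. Pow (?A F))"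
      using \<phi>[OF B] \<phi>_unique[OF B \<phi>[OF B]] by blast
  qed
  also have "\<dots> = transition_poly E \<F> w x 0 y"
    using finite_ground by (rule transition_poly_0[symmetric])
  finally show ?thesis by (rule sym)
qed

end
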